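(* Let $m\ge 1$, $a\ge 1$ and $D_1,\dots,D_m\ge 1$ be integers and put $n=D_1+\cdots+D_m$. Consider a deck of $n$ cards with $D_i$ cards labeled $i$, $i=1,\dots,m$. Then the separation distance after an $a$-shuffle of the sorted deck ($1$'s on top, followed by $2$'s, etc., with $m$'s on the bottom) is $$1-\frac{1}{a^n}\binom{n}{D_1,\dots,D_m}\sum_{0=k_0<k_1<\cdots<k_{m-1}<a}(a-k_{m-1})^{D_m}\prod_{j=1}^{m-1}\Big((k_j-k_{j-1})^{D_j}-(k_j-k_{j-1}-1)^{D_j}\Big),$$ where the sum is over integers $k_1,\dots,k_{m-1}$ satisfying the indicated inequalities with $k_0=0$.
   Context: $a$-shuffle of $n$ cards: the deck is cut into $a$ consecutive packets of sizes $A_1,\dots,A_a\ge 0$ (packet $1$ on top, empty packets allowed), $A_1+\cdots+A_a=n$, with probability $a^{-n}\binom{n}{A_1,\dots,A_a}$; the packets are then riffled together by dropping cards one at a time from the bottoms of the packets, the next card coming from a given packet with probability proportional to its current size (equivalently, all interleavings preserving the order within each packet are equally likely). Cards with the same label are indistinguishable, so a deck configuration is a word $w$ containing $D_i$ letters $i$ for each $i$. If $Q_a(w)$ is the probability that the $a$-shuffle results in configuration $w$, the separation distance is $\max_w\big(1-Q_a(w)/U\big)$, where $U=1/\binom{n}{D_1,\dots,D_m}$ is the uniform probability and the maximum is over all configurations. *)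

theory Defs
  imports "HOL-Probability.Probability" "HOL-Combinatorics.Multiset_Permutations"
begin

definition multinomial :: "nat list \<Rightarrow> nat" where
  "multinomial ks = fact (sum_list ks) div prod_list (map fact ks)"

definition compositions :: "nat \<Rightarrow> nat \<Rightarrow> nat list set" where
  "compositions a n = {A. length A = a \<and> sum_list A = n}"

(* The packet sizes A_1, ..., A_a. The defining function sums to 1 when a \<ge> 1 (see
   pmf_packet_sizes); for a = 0 < n there is no composition and the value is unspecified. *)
definition packet_sizes :: "nat \<Rightarrow> nat \<Rightarrow> nat list pmf" where
  "packet_sizes a n =
     embed_pmf (\<lambda>A. if A \<in> compositions a n then real (multinomial A) / real a ^ n else 0)"

(* Decks and packets are lists with the top card at the head. *)
primrec cut :: "nat list \<Rightarrow> 'c list \<Rightarrow> 'c list list" where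
  "cut [] xs = []"
| "cut (k # ks) xs = take k xs # cut ks (drop k xs)"

(* Index of the packet that drops next; meaningful as long as some packet is nonempty
   (see pmf_next_packet). *)
definition next_packet :: "'c list list \<Rightarrow> nat pmf" where
  "next_packet ps =
     embed_pmf (\<lambda>i. if i < length ps
       then real (length (ps ! i)) / real (\<Sum>j<length ps. length (ps ! j)) else 0)"

(* Perform N drops. The bottom card of the chosen packet falls first, so it ends up below
   all cards that are dropped later. *)
primrec drop_cards :: "nat \<Rightarrow> 'c list list \<Rightarrow> 'c list pmf" where
  "drop_cards 0 ps = return_pmf []"
| "drop_cards (Suc N) ps =
     bind_pmf (next_packet ps)
       (\<lambda>i. map_pmf (\<lambda>w. w @ [last (ps ! i)]) (drop_cards N (ps[i := butlast (ps ! i)])))"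

definition a_shuffle :: "nat \<Rightarrow> 'c list \<Rightarrow> 'c list pmf" where
  "a_shuffle a deck =
     bind_pmf (packet_sizes a (length deck)) (\<lambda>A. drop_cards (length deck) (cut A deck))"

definition sorted_deck :: "nat \<Rightarrow> (nat \<Rightarrow> nat) \<Rightarrow> nat list" where
  "sorted_deck m D = concat (map (\<lambda>i. replicate (D i) i) [1..<Suc m])"

definition configurations :: "nat \<Rightarrow> (nat \<Rightarrow> nat) \<Rightarrow> nat list set" where
  "configurations m D = {w. set w \<subseteq> {1..m} \<and> (\<forall>i\<in>{1..m}. count_list w i = D i)}"

definition separation_distance :: "nat \<Rightarrow> nat \<Rightarrow> (nat \<Rightarrow> nat) \<Rightarrow> real" where
  "separation_distance a m D =
     (let U = 1 / real (multinomial (map D [1..<Suc m]))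
      in MAX w\<in>configurations m D. 1 - pmf (a_shuffle a (sorted_deck m D)) w / U)"

(* Integer sequences 0 = k_0 < k_1 < ... < k_{m-1} < a; extensionality outside {0..m-1} makes
   each sequence correspond to exactly one function. *)
definition index_chains :: "nat \<Rightarrow> nat \<Rightarrow> (nat \<Rightarrow> int) set" where
  "index_chains m a =
     {k \<in> extensional {0..m-1}.
        k 0 = 0 \<and> (\<forall>j\<in>{1..m-1}. k (j - 1) < k j) \<and> k (m - 1) < int a}"


subsection \<open>The objects above are well defined\<close>

lemma prod_fact_dvd: "prod_list (map fact ks) dvd (fact (sum_list ks) :: nat)"
proof (induction ks)
  case (Cons k ks)
  have "fact k * prod_list (map fact ks) dvd (fact k * fact (sum_list ks) :: nat)"
    using Cons by simp
  also have "\<dots> dvd fact (k + sum_list ks)"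
    by (rule fact_fact_dvd_fact)
  finally show ?case by simp
qed simp

lemma real_multinomial:
  "real (multinomial ks) = fact (sum_list ks) / prod_list (map fact ks)"
proof -
  have "real (prod_list (map fact ks)) = prod_list (map fact ks)"
    by (induction ks) auto
  then show ?thesis
    unfolding multinomial_def by (simp add: real_of_nat_div[OF prod_fact_dvd])
qed

lemma multinomial_Cons:
  "real (multinomial (k # ks)) = real ((k + sum_list ks) choose k) * real (multinomial ks)"
  by (simp add: real_multinomial binomial_fact)

lemma compositions_Suc:
  "compositions (Suc a) n = (\<Union>k\<le>n. (#) k ` compositions a (n - k))"
  by (auto simp: compositions_def length_Suc_conv image_iff)

lemma finite_compositions: "finite (compositions a n)"
  by (induction a arbitrary: n) (auto simp: compositions_Suc, simp add: compositions_def)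

lemma sum_multinomial: "(\<Sum>A\<in>compositions a n. real (multinomial A)) = real a ^ n"
proof (induction a arbitrary: n)
  case 0
  have "compositions 0 n = (if n = 0 then {[]} else {})"
    by (auto simp: compositions_def)
  then show ?case by (auto simp: multinomial_def)
next
  case (Suc a)
  have "(\<Sum>A\<in>compositions (Suc a) n. real (multinomial A))
      = (\<Sum>k\<le>n. \<Sum>A\<in>(#) k ` compositions a (n - k). real (multinomial A))"
    unfolding compositions_Suc
    by (rule sum.UNION_disjoint) (auto simp: finite_compositions)
  also have "\<dots> = (\<Sum>k\<le>n. \<Sum>A\<in>compositions a (n - k). real (n choose k) * real (multinomial A))"
  proof (rule sum.cong[OF refl])
    fix k assume "k \<in> {..n}"
    then show "(\<Sum>A\<in>(#) k ` compositions a (n - k). real (multinomial A))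
      = (\<Sum>A\<in>compositions a (n - k). real (n choose k) * real (multinomial A))"
      by (subst sum.reindex) (auto simp: multinomial_Cons compositions_def intro!: sum.cong)
  qed
  also have "\<dots> = (\<Sum>k\<le>n. real (n choose k) * real a ^ (n - k))"
    by (simp add: sum_distrib_left[symmetric] Suc)
  also have "\<dots> = real (Suc a) ^ n"
    using binomial_ring[of 1 "real a" n] by (simp add: add.commute)
  finally show ?case .
qed

lemma nn_integral_finite_support:
  fixes g :: "'c \<Rightarrow> real"
  assumes "finite S" "\<And>x. x \<in> S \<Longrightarrow> 0 \<le> g x" "(\<Sum>x\<in>S. g x) = 1"
  shows "(\<integral>\<^sup>+x. ennreal (if x \<in> S then g x else 0) \<partial>count_space UNIV) = 1"
proof -
  have "(\<integral>\<^sup>+x. ennreal (if x \<in> S then g x else 0) \<partial>count_space UNIV)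
      = (\<Sum>x\<in>S. ennreal (if x \<in> S then g x else 0))"
    by (rule nn_integral_count_space'[OF assms(1)]) auto
  also have "\<dots> = (\<Sum>x\<in>S. ennreal (g x))" by simp
  also have "\<dots> = ennreal (\<Sum>x\<in>S. g x)" by (rule sum_ennreal) (use assms in auto)
  finally show ?thesis using assms by simp
qed

lemma pmf_packet_sizes:
  assumes "a \<ge> 1"
  shows "pmf (packet_sizes a n) A =
    (if A \<in> compositions a n then real (multinomial A) / real a ^ n else 0)"
  unfolding packet_sizes_def
proof (rule pmf_embed_pmf)
  show "(\<integral>\<^sup>+x. ennreal (if x \<in> compositions a n then real (multinomial x) / real a ^ n else 0)
      \<partial>count_space UNIV) = 1"
    by (rule nn_integral_finite_support)
       (use assms in \<open>auto simp: finite_compositions sum_multinomial sum_divide_distrib[symmetric]\<close>)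
qed auto

lemma pmf_next_packet:
  assumes "\<exists>p\<in>set ps. p \<noteq> []"
  shows "pmf (next_packet ps) i = (if i < length ps
    then real (length (ps ! i)) / real (\<Sum>j<length ps. length (ps ! j)) else 0)"
  unfolding next_packet_def
proof (rule pmf_embed_pmf)
  have "(\<Sum>j<length ps. length (ps ! j)) > 0"
  proof -
    obtain i where "i < length ps" "ps ! i \<noteq> []"
      using assms by (auto simp: in_set_conv_nth)
    then show ?thesis by (intro sum_pos2[of _ i]) auto
  qed
  then have "(\<Sum>i<length ps. real (length (ps ! i)) / real (\<Sum>j<length ps. length (ps ! j))) = 1"
    unfolding sum_divide_distrib[symmetric] of_nat_sum[symmetric] by (metis divide_self of_nat_0_eq_iff less_irrefl)
  from nn_integral_finite_support[OF finite_lessThan divide_nonneg_nonneg[OF of_nat_0_le_iff of_nat_0_le_iff] this]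
  show "(\<integral>\<^sup>+i. ennreal (if i < length ps
      then real (length (ps ! i)) / real (\<Sum>j<length ps. length (ps ! j)) else 0)
      \<partial>count_space UNIV) = 1" by (simp only: lessThan_iff)
qed (auto intro!: divide_nonneg_nonneg sum_nonneg)

lemma count_sorted_deck:
  "count (mset (sorted_deck m D)) i = (if i \<in> {1..m} then D i else 0)"
  unfolding sorted_deck_def by (induction m) auto

lemma length_sorted_deck: "length (sorted_deck m D) = (\<Sum>i=1..m. D i)"
  unfolding sorted_deck_def by (induction m) auto

lemma configurations_eq: "configurations m D = permutations_of_multiset (mset (sorted_deck m D))"
proof (intro set_eqI)
  fix w
  have "w \<in> configurations m D \<longleftrightarrow> (\<forall>i. count_list w i = (if i \<in> {1..m} then D i else 0))"
    unfolding configurations_def by (auto simp: count_list_0_iff subset_iff)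
  also have "\<dots> \<longleftrightarrow> mset w = mset (sorted_deck m D)"
    unfolding multiset_eq_iff count_sorted_deck by (simp only: count_mset)
  finally show "w \<in> configurations m D \<longleftrightarrow> w \<in> permutations_of_multiset (mset (sorted_deck m D))"
    by (simp add: permutations_of_multiset_def)
qed

lemma card_configurations: "card (configurations m D) = multinomial (map D [1..<Suc m])"
proof -
  have "(\<Prod>i\<in>set_mset (mset (sorted_deck m D)). fact (count (mset (sorted_deck m D)) i))
      = (\<Prod>i\<in>{1..m}. fact (D i) :: nat)"
    by (rule prod.mono_neutral_cong_left)
       (auto simp: count_sorted_deck count_greater_zero_iff[symmetric]
         simp del: count_greater_zero_iff set_mset_mset split: if_splits)
  also have "\<dots> = prod_list (map fact (map D [1..<Suc m]))"
    by (induction m) auto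
  moreover have "size (mset (sorted_deck m D)) = sum_list (map D [1..<Suc m])"
    unfolding sorted_deck_def by (induction m) auto
  ultimately show ?thesis
    by (simp add: configurations_eq card_permutations_of_multiset multinomial_def
        del: size_mset upt_Suc)
qed

lemma finite_configurations: "finite (configurations m D)"
  and sorted_deck_in_configurations: "sorted_deck m D \<in> configurations m D"
  by (simp_all only: configurations_eq finite_permutations_of_multiset permutations_of_multisetI)

lemma finite_index_chains: "finite (index_chains m a)"
proof (rule finite_subset)
  show "index_chains m a \<subseteq> PiE {0..m-1} (\<lambda>_. {0..<int a})"
  proof
    fix k assume k: "k \<in> index_chains m a"
    have step: "k j < k (Suc j)" if "Suc j \<le> m - 1" for j
      using k that by (auto simp: index_chains_def Ball_def dest!: spec[of _ "Suc j"])
    have "0 \<le> k j" if "j \<le> m - 1" for j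
      using that
    proof (induction j)
      case (Suc j)
      with step[of j] show ?case by simp
    qed (use k in \<open>simp add: index_chains_def\<close>)
    moreover have "k (m - 1 - j) < int a" if "j \<le> m - 1" for j
      using that
    proof (induction j)
      case (Suc j)
      then have "Suc (m - 1 - Suc j) = m - 1 - j" by simp
      with Suc step[of "m - 1 - Suc j"] show ?case by (metis Suc_leD diff_le_self order.strict_trans)
    qed (use k in \<open>simp add: index_chains_def\<close>)
    then have "k j < int a" if "j \<le> m - 1" for j
      using that by (metis diff_diff_cancel diff_le_self)
    ultimately show "k \<in> PiE {0..m-1} (\<lambda>_. {0..<int a})"
      using k by (auto simp: index_chains_def PiE_def)
  qed
qed (auto intro!: finite_PiE)

end

theory Submission
  imports Defs
begin

text \<open>
  Record for every position of the shuffled deck the packet from which its card came. This turns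
  a shuffle of a deck of \<open>n\<close> cards into a word \<open>s\<close> of length \<open>n\<close> over \<open>{0, ..., a - 1}\<close>, and the
  original deck is recovered by listing the cards of packet \<open>0\<close>, then those of packet \<open>1\<close>, and so
  on. Dropping cards with probability proportional to the packet sizes makes all interleavings of
  given packets equally likely (\<open>pmf_drop_cards\<close>), each with probability the inverse of the
  multinomial coefficient of the sizes; the weight of the cut is that same coefficient divided by
  \<open>a ^ n\<close>. Hence every word has weight \<open>1 / a ^ n\<close>, and \<open>Q\<^sub>a(w)\<close> is the number of words that sort
  \<open>w\<close> back into the initial deck, divided by \<open>a ^ n\<close> (\<open>pmf_a_shuffle\<close>).

  The separation distance asks for the configuration \<open>w\<close> with the fewest such words. For the
  sorted deck, \<open>s\<close> sorts \<open>w\<close> back if and only if for labels \<open>c < c'\<close> every card labelled \<open>c\<close> came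
  from an earlier packet than every card labelled \<open>c'\<close>, or from the same packet while lying above
  it in \<open>w\<close>. Words in which the comparison of packets is always strict therefore work for every
  \<open>w\<close> (\<open>separated_words_subset_inverse_words\<close>), and their number depends only on the multiset of
  labels (\<open>card_separated_words_mset\<close>). When \<open>w\<close> is the reversed deck, a smaller label never lies
  above a larger one, so that ties are impossible and no other word works
  (\<open>inverse_words_descending\<close>). The minimum is thus attained at the reversed deck.

  It remains to count the separated words. Let \<open>k\<^sub>j\<close> be one more than the largest packet used by
  label \<open>j\<close>, for \<open>j < m\<close>. Then label \<open>j\<close> uses packets in \<open>{k\<^sub>j\<^sub>-\<^sub>1, ..., k\<^sub>j - 1}\<close> and does use the last
  of them, which gives the factor \<open>(k\<^sub>j - k\<^sub>j\<^sub>-\<^sub>1) ^ D\<^sub>j - (k\<^sub>j - k\<^sub>j\<^sub>-\<^sub>1 - 1) ^ D\<^sub>j\<close>, while label \<open>m\<close> is free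
  in \<open>{k\<^sub>m\<^sub>-\<^sub>1, ..., a - 1}\<close>. Formally, the count and the sum over chains satisfy the same recursion from
  \<open>m\<close> to \<open>m + 1\<close> labels, obtained by splitting according to \<open>x = k\<^sub>m\<close> (\<open>card_separated_words_append_replicate\<close> and
  \<open>chain_sum_Suc\<close>).
\<close>

section \<open>Riffling fixed packets\<close>

definition packet :: "'c list \<Rightarrow> nat list \<Rightarrow> nat \<Rightarrow> 'c list" where
  "packet w s i = map fst (filter (\<lambda>ct. snd ct = i) (zip w s))"

definition interleavings :: "'c list list \<Rightarrow> 'c list \<Rightarrow> nat list set" where
  "interleavings ps w = {s. length s = length w \<and> set s \<subseteq> {..<length ps} \<and>
     (\<forall>i<length ps. packet w s i = ps ! i)}"

lemma packet_snoc:
  "length s = length v \<Longrightarrow>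
    packet (v @ [c]) (s @ [i]) j = packet v s j @ (if i = j then [c] else [])"
  by (simp add: packet_def)

lemma interleavings_subset_lists:
  "interleavings ps w \<subseteq> {s. set s \<subseteq> {..<length ps} \<and> length s = length w}"
  by (auto simp: interleavings_def)

lemma finite_interleavings: "finite (interleavings ps w)"
  by (rule finite_subset[OF interleavings_subset_lists]) (simp add: finite_lists_length_eq)

text \<open>The bottom card of the riffled deck is the bottom card of the packet that drops first.\<close>
lemma interleavings_snoc:
  "interleavings ps (v @ [c]) =
    (\<Union>i\<in>{i. i < length ps \<and> ps ! i \<noteq> [] \<and> last (ps ! i) = c}.
       (\<lambda>s. s @ [i]) ` interleavings (ps[i := butlast (ps ! i)]) v)"
proof (intro equalityI subsetI)
  fix s assume s: "s \<in> interleavings ps (v @ [c])"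
  then have "s \<noteq> []" by (auto simp: interleavings_def)
  then obtain t i where st: "s = t @ [i]" by (metis rev_exhaust)
  from s have len: "length t = length v" and i: "i < length ps" and t: "set t \<subseteq> {..<length ps}"
    and pk: "\<And>j. j < length ps \<Longrightarrow> packet v t j @ (if i = j then [c] else []) = ps ! j"
    by (auto simp: interleavings_def st packet_snoc)
  then have pk': "\<And>j. j < length ps \<Longrightarrow> j \<noteq> i \<Longrightarrow> packet v t j = ps ! j"
    by (metis append_Nil2)
  have pi: "packet v t i @ [c] = ps ! i" using pk[OF i] by simp
  then have ne: "ps ! i \<noteq> []" "last (ps ! i) = c" "butlast (ps ! i) = packet v t i"
    by (metis snoc_eq_iff_butlast)+
  have "t \<in> interleavings (ps[i := butlast (ps ! i)]) v"
    using len t i ne(3) pk' by (auto simp: interleavings_def nth_list_update)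
  with i ne show "s \<in> (\<Union>i\<in>{i. i < length ps \<and> ps ! i \<noteq> [] \<and> last (ps ! i) = c}.
       (\<lambda>s. s @ [i]) ` interleavings (ps[i := butlast (ps ! i)]) v)"
    by (auto simp: st)
next
  fix s assume "s \<in> (\<Union>i\<in>{i. i < length ps \<and> ps ! i \<noteq> [] \<and> last (ps ! i) = c}.
       (\<lambda>s. s @ [i]) ` interleavings (ps[i := butlast (ps ! i)]) v)"
  then obtain i t where i: "i < length ps" "ps ! i \<noteq> []" "last (ps ! i) = c" and st: "s = t @ [i]"
    and t: "t \<in> interleavings (ps[i := butlast (ps ! i)]) v" by auto
  have "packet v t i @ [c] = ps ! i"
    using t i by (auto simp: interleavings_def)
  then show "s \<in> interleavings ps (v @ [c])"
    using t i unfolding interleavings_def st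
    by (auto simp: packet_snoc nth_list_update)
qed

lemma card_interleavings_snoc:
  "card (interleavings ps (v @ [c])) =
    (\<Sum>i<length ps. if ps ! i \<noteq> [] \<and> last (ps ! i) = c
       then card (interleavings (ps[i := butlast (ps ! i)]) v) else 0)"
proof -
  let ?I = "{i. i < length ps \<and> ps ! i \<noteq> [] \<and> last (ps ! i) = c}"
  have "card (interleavings ps (v @ [c])) =
      (\<Sum>i\<in>?I. card ((\<lambda>s. s @ [i]) ` interleavings (ps[i := butlast (ps ! i)]) v))"
    unfolding interleavings_snoc
    by (rule card_UN_disjoint) (auto simp: finite_interleavings)
  also have "\<dots> = (\<Sum>i\<in>?I. card (interleavings (ps[i := butlast (ps ! i)]) v))"
    by (intro sum.cong refl card_image) (auto simp: inj_on_def)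
  also have "\<dots> = (\<Sum>i<length ps. if ps ! i \<noteq> [] \<and> last (ps ! i) = c
       then card (interleavings (ps[i := butlast (ps ! i)]) v) else 0)"
    by (subst sum.inter_filter[symmetric]) (auto intro!: sum.cong)
  finally show ?thesis .
qed

lemma multinomial_pos: "multinomial ks > 0"
proof -
  have "prod_list (map fact ks) > (0::real)" by (induction ks) auto
  then have "real (multinomial ks) > 0" by (simp add: real_multinomial)
  then show ?thesis by simp
qed

text \<open>Choosing packet \<open>i\<close> first has probability \<open>Suc l / sum_list ks\<close>; this is the identity that
  keeps all interleavings equally likely after that choice.\<close>
lemma multinomial_decrement:
  assumes "i < length ks" "ks ! i = Suc l"
  shows "real (multinomial ks) * real (Suc l) =
    real (sum_list ks) * real (multinomial (ks[i := l]))"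
proof -
  have pos: "prod_list (map fact xs) \<noteq> (0::real)" for xs :: "nat list" by (induction xs) auto
  obtain xs ys where ks: "ks = xs @ Suc l # ys" and i: "i = length xs"
    using assms by (metis id_take_nth_drop length_take min.absorb4)
  then have "ks[i := l] = xs @ l # ys" by simp
  then show ?thesis
    by (simp add: ks real_multinomial divide_simps pos)
qed

lemma pmf_map_snoc:
  "pmf (map_pmf (\<lambda>w. w @ [x]) p) (v @ [c]) = (if x = c then pmf p v else 0)"
proof (cases "x = c")
  case True
  then show ?thesis
    using pmf_map_inj'[of "\<lambda>w. w @ [x]" p v] by (simp add: inj_def)
next
  case False
  then show ?thesis by (auto simp: pmf_eq_0_set_pmf)
qed

text \<open>Induct on the number of drops: the first drop fixes the bottom card, and the remaining drops
  riffle the packets without that card. The selection probability of a packet times the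
  multinomial coefficient of the full sizes is the multinomial coefficient of the reduced sizes,
  so that the inductive weights combine to one common weight.\<close>
lemma pmf_drop_cards:
  assumes "N = sum_list (map length ps)"
  shows "pmf (drop_cards N ps) w =
    real (card (interleavings ps w)) / real (multinomial (map length ps))"
  using assms
proof (induction N arbitrary: ps w)
  case 0
  then have empty: "\<And>i. i < length ps \<Longrightarrow> ps ! i = []"
    by (auto simp: sum_list_eq_0_iff)
  have "interleavings ps w = (if w = [] then {[]} else {})"
  proof (cases w rule: rev_cases)
    case Nil
    then show ?thesis using empty by (auto simp: interleavings_def packet_def)
  next
    case (snoc v c)
    then show ?thesis using empty by (auto simp: interleavings_snoc)
  qed
  moreover have "multinomial (map length ps) = 1"
  proof -
    have "map length ps = replicate (length ps) 0"
      using empty by (intro nth_equalityI) auto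
    then show ?thesis by (simp add: multinomial_def sum_list_replicate)
  qed
  ultimately show ?case by simp
next
  case (Suc N)
  have "\<exists>p\<in>set ps. p \<noteq> []"
    using Suc.prems by (metis map_replicate_const length_0_conv map_cong sum_list_replicate mult_0_right nat.distinct(1))
  note nx = pmf_next_packet[OF this]
  have tot: "(\<Sum>j<length ps. length (ps ! j)) = Suc N"
    using Suc.prems by (simp add: sum_list_sum_nth atLeast0LessThan)
  have bind: "pmf (drop_cards (Suc N) ps) w = (\<Sum>i<length ps.
      pmf (map_pmf (\<lambda>w. w @ [last (ps ! i)]) (drop_cards N (ps[i := butlast (ps ! i)]))) w *
      pmf (next_packet ps) i)"
    unfolding drop_cards.simps pmf_bind
    by (subst integral_measure_pmf_real[where A = "{..<length ps}"])
       (auto simp: nx set_pmf_iff split: if_splits)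
  show ?case
  proof (cases w rule: rev_cases)
    case Nil
    obtain i where i: "i < length ps" "ps ! i \<noteq> []"
      using \<open>\<exists>p\<in>set ps. p \<noteq> []\<close> by (auto simp: in_set_conv_nth)
    then have "interleavings ps w = {}"
      by (auto simp: Nil interleavings_def packet_def)
    moreover have "pmf (drop_cards (Suc N) ps) w = 0"
      by (auto simp: pmf_eq_0_set_pmf Nil)
    ultimately show ?thesis by simp
  next
    case (snoc v c)
    let ?M = "real (multinomial (map length ps))"
    have "pmf (drop_cards (Suc N) ps) w = (\<Sum>i<length ps.
        (if ps ! i \<noteq> [] \<and> last (ps ! i) = c
         then real (card (interleavings (ps[i := butlast (ps ! i)]) v)) else 0) / ?M)"
      unfolding bind
    proof (rule sum.cong[OF refl])
      fix i assume "i \<in> {..<length ps}"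
      then have i: "i < length ps" by simp
      show "pmf (map_pmf (\<lambda>w. w @ [last (ps ! i)]) (drop_cards N (ps[i := butlast (ps ! i)]))) w *
          pmf (next_packet ps) i =
        (if ps ! i \<noteq> [] \<and> last (ps ! i) = c
         then real (card (interleavings (ps[i := butlast (ps ! i)]) v)) else 0) / ?M"
      proof (cases "ps ! i = []")
        case True
        then show ?thesis by (simp add: nx)
      next
        case False
        then obtain l where l: "length (ps ! i) = Suc l" by (metis length_greater_0_conv gr0_conv_Suc)
        have lens: "map length (ps[i := butlast (ps ! i)]) = (map length ps)[i := l]"
          by (simp add: map_update l)
        have "N = sum_list (map length (ps[i := butlast (ps ! i)]))"
          unfolding lens using Suc.prems i l by (simp add: sum_list_update)
        note IH = Suc.IH[OF this, of v, unfolded lens]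
        have dec: "?M * real (Suc l) = real (Suc N) * real (multinomial ((map length ps)[i := l]))"
          using multinomial_decrement[of i "map length ps" l] i l Suc.prems by simp
        have "0 < ?M" "0 < real (multinomial ((map length ps)[i := l]))"
          using multinomial_pos by simp_all
        then show ?thesis
          using dec i l False unfolding snoc pmf_map_snoc nx tot IH
          by (simp add: field_simps del: of_nat_Suc)
      qed
    qed
    then show ?thesis
      by (simp add: snoc card_interleavings_snoc sum_divide_distrib if_distrib cong: if_cong)
  qed
qed

section \<open>The a-shuffle counts words\<close>

lemma length_cut: "length (cut ks xs) = length ks"
  by (induction ks arbitrary: xs) auto

lemma map_length_cut: "sum_list ks = length xs \<Longrightarrow> map length (cut ks xs) = ks"
  by (induction ks arbitrary: xs) auto

text \<open>A list of packets determines the cut that produced it, so summing over all cuts amounts to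
  forgetting the packet sizes.\<close>
lemma cut_iff:
  "sum_list ks = length xs \<Longrightarrow> ps = cut ks xs \<longleftrightarrow> map length ps = ks \<and> concat ps = xs"
proof (induction ks arbitrary: xs ps)
  case (Cons k ks)
  then have "k \<le> length xs" by simp
  with Cons show ?case
    by (cases ps) (auto simp: append_eq_conv_conj)
qed auto

text \<open>Concatenating the packets is the inverse shuffle: mark each card of \<open>w\<close> with a packet and sort
  stably by these marks.\<close>
definition inverse_words :: "nat \<Rightarrow> 'c list \<Rightarrow> 'c list \<Rightarrow> nat list set" where
  "inverse_words a deck w = {s. length s = length w \<and> set s \<subseteq> {..<a} \<and>
     concat (map (packet w s) [0..<a]) = deck}"

lemma inverse_words_eq_UN:
  "inverse_words a deck w = (\<Union>A\<in>compositions a (length deck). interleavings (cut A deck) w)"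
proof -
  have iff: "s \<in> interleavings (cut A deck) w \<longleftrightarrow>
      length s = length w \<and> set s \<subseteq> {..<a} \<and> map (packet w s) [0..<a] = cut A deck"
    if "A \<in> compositions a (length deck)" for A s
    using that by (auto simp: interleavings_def length_cut compositions_def list_eq_iff_nth_eq)
  show ?thesis
  proof (intro set_eqI iffI)
    fix s assume s: "s \<in> inverse_words a deck w"
    let ?ps = "map (packet w s) [0..<a]"
    have A: "map length ?ps \<in> compositions a (length deck)"
      using s by (auto simp: inverse_words_def compositions_def length_concat)
    then have sum: "sum_list (map length ?ps) = length deck" by (simp add: compositions_def)
    have "concat ?ps = deck" using s by (simp add: inverse_words_def)
    then have "?ps = cut (map length ?ps) deck" using cut_iff[OF sum, of ?ps] by blast
    then have "s \<in> interleavings (cut (map length ?ps) deck) w"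
      using s unfolding iff[OF A] inverse_words_def by blast
    with A show "s \<in> (\<Union>A\<in>compositions a (length deck). interleavings (cut A deck) w)"
      by blast
  next
    fix s assume "s \<in> (\<Union>A\<in>compositions a (length deck). interleavings (cut A deck) w)"
    then obtain A where A: "A \<in> compositions a (length deck)"
      and s: "s \<in> interleavings (cut A deck) w" by auto
    have "sum_list A = length deck" using A by (simp add: compositions_def)
    from cut_iff[OF this, of "map (packet w s) [0..<a]"] s iff[OF A]
    show "s \<in> inverse_words a deck w" by (simp add: inverse_words_def)
  qed
qed

lemma interleavings_cut_disjoint:
  assumes "A \<in> compositions a (length deck)" "B \<in> compositions a (length deck)" "A \<noteq> B"
  shows "interleavings (cut A deck) w \<inter> interleavings (cut B deck) w = {}"
proof -
  have "map length (cut A deck) \<noteq> map length (cut B deck)"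
    using assms by (simp add: map_length_cut compositions_def)
  moreover have "cut A deck = cut B deck"
    if "s \<in> interleavings (cut A deck) w" "s \<in> interleavings (cut B deck) w" for s
    using that assms by (intro nth_equalityI) (auto simp: interleavings_def length_cut compositions_def)
  ultimately show ?thesis by force
qed

text \<open>The multinomial weight of a cut cancels against the uniform weight of its interleavings, which
  leaves \<open>1 / a ^ n\<close> for every word.\<close>
lemma pmf_a_shuffle:
  assumes "a \<ge> 1"
  shows "pmf (a_shuffle a deck) w = real (card (inverse_words a deck w)) / real a ^ length deck"
proof -
  let ?C = "compositions a (length deck)"
  have "pmf (a_shuffle a deck) w =
      (\<Sum>A\<in>?C. pmf (drop_cards (length deck) (cut A deck)) w * pmf (packet_sizes a (length deck)) A)"
    unfolding a_shuffle_def pmf_bind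
    by (subst integral_measure_pmf_real[where A = ?C])
       (auto simp: pmf_packet_sizes[OF assms] set_pmf_iff finite_compositions split: if_splits)
  also have "\<dots> = (\<Sum>A\<in>?C. real (card (interleavings (cut A deck) w)) / real a ^ length deck)"
  proof (rule sum.cong[OF refl])
    fix A assume A: "A \<in> ?C"
    then have "map length (cut A deck) = A" "sum_list A = length deck"
      by (simp_all add: map_length_cut compositions_def)
    then show "pmf (drop_cards (length deck) (cut A deck)) w * pmf (packet_sizes a (length deck)) A =
        real (card (interleavings (cut A deck) w)) / real a ^ length deck"
      using A multinomial_pos[of A] by (simp add: pmf_drop_cards pmf_packet_sizes[OF assms])
  qed
  also have "\<dots> = real (card (inverse_words a deck w)) / real a ^ length deck"
    unfolding inverse_words_eq_UN sum_divide_distrib[symmetric]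
    by (subst card_UN_disjoint)
       (auto simp: finite_compositions finite_interleavings dest: interleavings_cut_disjoint)
  finally show ?thesis .
qed

section \<open>The least likely configuration\<close>

text \<open>The pairs in \<open>zip w s\<close> record the label and the packet of each card. The condition refers only
  to the set of these pairs and not to positions, which makes it invariant under simultaneous
  permutation of \<open>w\<close> and \<open>s\<close>.\<close>
definition separated :: "nat list \<Rightarrow> nat list \<Rightarrow> bool" where
  "separated w s \<longleftrightarrow> (\<forall>(c, t)\<in>set (zip w s). \<forall>(c', t')\<in>set (zip w s). c < c' \<longrightarrow> t < t')"

definition separated_words :: "nat \<Rightarrow> nat list \<Rightarrow> nat list set" where
  "separated_words a w = {s. length s = length w \<and> set s \<subseteq> {..<a} \<and> separated w s}"

lemma set_packet: "set (packet w s i) = {c. (c, i) \<in> set (zip w s)}"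
  by (force simp: packet_def)

lemma mset_concat_packets:
  "length s = length w \<Longrightarrow> set s \<subseteq> {..<a} \<Longrightarrow> mset (concat (map (packet w s) [0..<a])) = mset w"
proof (induction s w rule: list_induct2)
  case Nil
  then show ?case by (simp add: packet_def mset_concat)
next
  case (Cons i s c w)
  have eq: "mset (packet (c # w) (i # s) j) = mset (packet w s j) + (if i = j then {#c#} else {#})" for j
    by (simp add: packet_def)
  have "mset (concat (map (packet (c # w) (i # s)) [0..<a])) =
      (\<Sum>j<a. mset (packet w s j)) + (\<Sum>j<a. if i = j then {#c#} else {#})"
    by (simp add: mset_concat interv_sum_list_conv_sum_set_nat eq sum.distrib atLeast0LessThan comp_def)
  also have "(\<Sum>j<a. if i = j then {#c#} else {#}) = {#c#}"
    using Cons.prems by simp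
  finally show ?case
    using Cons by (simp add: mset_concat interv_sum_list_conv_sum_set_nat atLeast0LessThan comp_def)
qed

lemma sorted_concat_iff:
  "sorted (concat (map f [0..<a])) \<longleftrightarrow>
    (\<forall>i<a. sorted (f i)) \<and> (\<forall>i j. i < j \<and> j < a \<longrightarrow> (\<forall>x\<in>set (f i). \<forall>y\<in>set (f j). x \<le> y))"
  (is "_ \<longleftrightarrow> ?S a \<and> ?L a")
proof (induction a)
  case (Suc a)
  have S: "?S (Suc a) \<longleftrightarrow> ?S a \<and> sorted (f a)"
    unfolding less_Suc_eq by blast
  have L: "?L (Suc a) \<longleftrightarrow> ?L a \<and> (\<forall>i<a. \<forall>x\<in>set (f i). \<forall>y\<in>set (f a). x \<le> y)"
    unfolding less_Suc_eq by blast
  have "sorted (concat (map f [0..<Suc a])) \<longleftrightarrow>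
      sorted (concat (map f [0..<a])) \<and> sorted (f a) \<and>
      (\<forall>i<a. \<forall>x\<in>set (f i). \<forall>y\<in>set (f a). x \<le> y)"
    by (auto simp: sorted_append)
  then show ?case
    unfolding S L Suc.IH by (simp only: conj_ac)
qed simp

text \<open>In a separated word each packet holds cards of a single label, and later packets hold labels
  at least as large; sorting by packets then sorts the labels, whatever the order of \<open>w\<close>.\<close>
lemma separated_words_subset_inverse_words:
  assumes "mset w = mset deck" "sorted deck"
  shows "separated_words a w \<subseteq> inverse_words a deck w"
proof
  fix s assume s: "s \<in> separated_words a w"
  then have len: "length s = length w" and sub: "set s \<subseteq> {..<a}"
    and sep: "\<And>c t c' t'. (c, t) \<in> set (zip w s) \<Longrightarrow> (c', t') \<in> set (zip w s) \<Longrightarrow> c < c' \<Longrightarrow> t < t'"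
    by (auto simp: separated_words_def separated_def)
  have "sorted (packet w s i)" for i
  proof -
    have "x = y" if "x \<in> set (packet w s i)" "y \<in> set (packet w s i)" for x y
      using that sep[of x i y i] sep[of y i x i]
      by (cases x y rule: linorder_cases) (auto simp: set_packet)
    then show ?thesis
      by (auto simp: sorted_iff_nth_mono) (metis eq_refl nth_mem order_le_less_trans)
  qed
  moreover have "x \<le> y" if "i < j" "x \<in> set (packet w s i)" "y \<in> set (packet w s j)" for i j x y
    using that sep[of y j x i] by (cases "y < x") (auto simp: set_packet)
  ultimately have "sorted (concat (map (packet w s) [0..<a]))"
    by (auto simp: sorted_concat_iff)
  then have "concat (map (packet w s) [0..<a]) = deck"
    using mset_concat_packets[OF len sub] assms by (metis properties_for_sort)
  then show "s \<in> inverse_words a deck w"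
    using len sub by (simp add: inverse_words_def)
qed

lemma sorted_wrt_packet:
  assumes "sorted_wrt P w"
  shows "sorted_wrt P (packet w s i)"
  using assms
proof (induction w arbitrary: s)
  case (Cons c w)
  then show ?case
    by (cases s) (auto simp: packet_def dest: set_zip_leftD)
qed (simp add: packet_def)

text \<open>A packet cut from a sorted deck is ascending, but as a subsequence of a descending
  configuration it is descending as well. Two different labels therefore never share a packet, and
  weak inequalities between packets become strict.\<close>
lemma inverse_words_descending:
  assumes "sorted deck" "sorted_wrt (\<ge>) w"
  shows "inverse_words a deck w \<subseteq> separated_words a w"
proof
  fix s assume s: "s \<in> inverse_words a deck w"
  then have len: "length s = length w" and sub: "set s \<subseteq> {..<a}"
    and "sorted (concat (map (packet w s) [0..<a]))"
    using assms by (auto simp: inverse_words_def)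
  then have asc: "\<And>i. i < a \<Longrightarrow> sorted (packet w s i)"
    and across: "\<And>i j x y. i < j \<Longrightarrow> j < a \<Longrightarrow> x \<in> set (packet w s i) \<Longrightarrow> y \<in> set (packet w s j) \<Longrightarrow> x \<le> y"
    by (auto simp: sorted_concat_iff)
  have "t < t'" if ct: "(c, t) \<in> set (zip w s)" "(c', t') \<in> set (zip w s)" "c < c'" for c t c' t'
  proof (rule ccontr)
    assume "\<not> t < t'"
    have ta: "t < a" using ct(1) sub by (auto dest: set_zip_rightD)
    have mem: "c \<in> set (packet w s t)" "c' \<in> set (packet w s t')" using ct by (simp_all add: set_packet)
    with \<open>\<not> t < t'\<close> across[of t' t c' c] ta \<open>c < c'\<close> have "t = t'" by force
    \<comment> \<open>Both labels lie in the same packet, which is at once ascending and descending.\<close>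
    with mem obtain p q where pq: "p < length (packet w s t)" "packet w s t ! p = c"
      "q < length (packet w s t)" "packet w s t ! q = c'" by (metis in_set_conv_nth)
    have "sorted_wrt (\<ge>) (packet w s t)" using assms(2) by (rule sorted_wrt_packet)
    then have "p < q \<Longrightarrow> c \<ge> c'" using pq sorted_wrt_nth_less by metis
    moreover have "q \<le> p \<Longrightarrow> c' \<le> c" using asc[OF ta] pq sorted_nth_mono by metis
    ultimately show False using \<open>c < c'\<close> by force
  qed
  then show "s \<in> separated_words a w"
    using len sub by (auto simp: separated_words_def separated_def)
qed

lemma finite_separated_words: "finite (separated_words a w)"
  by (rule finite_subset[of _ "{s. set s \<subseteq> {..<a} \<and> length s = length w}"])
     (auto simp: separated_words_def finite_lists_length_eq)

lemma finite_inverse_words: "finite (inverse_words a deck w)"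
  by (simp add: inverse_words_eq_UN finite_compositions finite_interleavings)

text \<open>A permutation that carries \<open>w\<close> to \<open>w'\<close> carries separated words injectively along.\<close>
lemma card_separated_words_le:
  assumes "mset w = mset w'"
  shows "card (separated_words a w) \<le> card (separated_words a w')"
proof -
  obtain f where f: "f permutes {..<length w}" "permute_list f w = w'"
    using mset_eq_permutation[OF assms[symmetric]] by auto
  have "permute_list f ` separated_words a w \<subseteq> separated_words a w'"
  proof (rule image_subsetI)
    fix s assume s: "s \<in> separated_words a w"
    then have len: "length s = length w" by (simp add: separated_words_def)
    have "zip w' (permute_list f s) = permute_list f (zip w s)"
      using f len by (simp add: permute_list_zip[where A = "{..<length w}"])
    then have "set (zip w' (permute_list f s)) = set (zip w s)"
      using f len by (simp add: set_permute_list)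
    moreover have "set (permute_list f s) = set s" using f len by (simp add: set_permute_list)
    ultimately show "permute_list f s \<in> separated_words a w'"
      using s assms by (auto simp: separated_words_def separated_def dest: mset_eq_length)
  qed
  moreover have "inj_on (permute_list f) (separated_words a w)"
  proof (rule inj_onI)
    fix s t assume st: "s \<in> separated_words a w" "t \<in> separated_words a w"
      "permute_list f s = permute_list f t"
    then have len: "length s = length w" "length t = length w" by (auto simp: separated_words_def)
    show "s = t"
    proof (rule nth_equalityI)
      fix p assume "p < length s"
      then have p: "p < length w" using len by simp
      then obtain q where q: "q < length w" "f q = p"
        using f(1) by (metis lessThan_iff permutes_surj permutes_in_image surj_def)
      then show "s ! p = t ! p"
        using st(3) f(1) len by (metis permute_list_nth)
    qed (use len in simp)
  qed
  ultimately show ?thesis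
    by (metis card_image card_mono finite_separated_words)
qed

lemma card_separated_words_mset:
  "mset w = mset w' \<Longrightarrow> card (separated_words a w) = card (separated_words a w')"
  by (metis card_separated_words_le order_antisym)

section \<open>Counting separated words\<close>

lemma separated_append:
  assumes "length s = length w" "length s' = length w'" "\<And>c c'. c \<in> set w \<Longrightarrow> c' \<in> set w' \<Longrightarrow> c < c'"
  shows "separated (w @ w') (s @ s') \<longleftrightarrow>
    separated w s \<and> separated w' s' \<and> (\<forall>t\<in>set s. \<forall>t'\<in>set s'. t < t')"
proof -
  define Z Z' where "Z = set (zip w s)" "Z' = set (zip w' s')"
  have zip: "set (zip (w @ w') (s @ s')) = Z \<union> Z'"
    using assms(1) by (simp add: Z_Z'_def)
  have "set s = snd ` Z" "set s' = snd ` Z'"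
    using assms(1,2) unfolding Z_Z'_def set_map[symmetric] by simp_all
  then have cross: "(\<forall>t\<in>set s. \<forall>t'\<in>set s'. t < t') \<longleftrightarrow> (\<forall>(c, t)\<in>Z. \<forall>(c', t')\<in>Z'. t < t')"
    by force
  have lt: "c < c'" if "(c, t) \<in> Z" "(c', t') \<in> Z'" for c t c' t'
    using that assms(3) unfolding Z_Z'_def by (meson set_zip_leftD)
  \<comment> \<open>The separation condition between two groups of cards; only the mixed group \<open>R Z Z'\<close> is new.\<close>
  define R :: "(nat \<times> nat) set \<Rightarrow> (nat \<times> nat) set \<Rightarrow> bool"
    where "R X Y \<longleftrightarrow> (\<forall>(c, t)\<in>X. \<forall>(c', t')\<in>Y. c < c' \<longrightarrow> t < t')" for X Y
  have sep: "separated v u \<longleftrightarrow> R (set (zip v u)) (set (zip v u))" for v u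
    by (simp add: separated_def R_def)
  have left: "R (X \<union> Y) W \<longleftrightarrow> R X W \<and> R Y W" for X Y W
    by (simp add: R_def ball_Un)
  have right: "R W (X \<union> Y) \<longleftrightarrow> R W X \<and> R W Y" for X Y W
    by (simp add: R_def ball_Un split_def ball_conj_distrib)
  have "R Z' Z"
    unfolding R_def using lt by (force dest: less_asym)
  moreover have "R Z Z' \<longleftrightarrow> (\<forall>(c, t)\<in>Z. \<forall>(c', t')\<in>Z'. t < t')"
    unfolding R_def using lt by blast
  ultimately show ?thesis
    unfolding cross sep zip left right by (auto simp: Z_Z'_def)
qed

lemma separated_replicate: "separated (replicate d c) s"
  by (auto simp: separated_def dest!: set_zip_leftD)

lemma sorted_deck_Suc: "sorted_deck (Suc m) D = sorted_deck m D @ replicate (D (Suc m)) (Suc m)"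
  by (simp add: sorted_deck_def)

lemma set_sorted_deck: "set (sorted_deck m D) \<subseteq> {1..m}"
  by (auto simp: sorted_deck_def)

lemma separated_words_mono: "x \<le> y \<Longrightarrow> separated_words x w \<subseteq> separated_words y w"
  by (auto simp: separated_words_def)

text \<open>The index \<open>x\<close> is one more than the largest packet used by \<open>w\<close>: the prefix is a separated word
  over \<open>{..<x}\<close> but not over \<open>{..<x - 1}\<close>, and the cards of the new largest label are free in
  \<open>{x..<a}\<close>. Since \<open>d\<close> is positive, \<open>x < a\<close>; for \<open>x = 0\<close> truncated subtraction makes the
  difference vanish, in accordance with \<open>w\<close> being nonempty.\<close>
lemma card_separated_words_append_replicate:
  assumes "w \<noteq> []" "d \<ge> 1" "\<And>c. c \<in> set w \<Longrightarrow> c < b"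
  shows "card (separated_words a (w @ replicate d b)) =
    (\<Sum>x<a. (card (separated_words x w) - card (separated_words (x - 1) w)) * (a - x) ^ d)"
proof -
  let ?L = "\<lambda>x. {s. set s \<subseteq> {x..<a} \<and> length s = d}"
  let ?F = "\<lambda>x. separated_words x w - separated_words (x - 1) w"
  have sep: "separated (w @ replicate d b) (s @ s') \<longleftrightarrow> separated w s \<and> (\<forall>t\<in>set s. \<forall>t'\<in>set s'. t < t')"
    if "length s = length w" "length s' = d" for s s'
    using that assms by (subst separated_append) (auto simp: separated_replicate)
  have UN: "separated_words a (w @ replicate d b) = (\<Union>x<a. (\<lambda>(s, s'). s @ s') ` (?F x \<times> ?L x))"
  proof (intro equalityI subsetI)
    fix u assume u: "u \<in> separated_words a (w @ replicate d b)"
    define s s' where "s = take (length w) u" "s' = drop (length w) u"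
    have us: "u = s @ s'" and len: "length s = length w" "length s' = d"
      using u by (auto simp: s_s'_def separated_words_def)
    have su: "set s \<subseteq> {..<a}" "set s' \<subseteq> {..<a}" "separated w s" and lt: "\<forall>t\<in>set s. \<forall>t'\<in>set s'. t < t'"
      using u len by (auto simp: separated_words_def us sep)
    have ne: "s \<noteq> []" "s' \<noteq> []" using len assms by auto
    \<comment> \<open>the least bound below which all packets of the prefix lie\<close>
    define x where "x = Suc (Max (set s))"
    have mx: "Max (set s) \<in> set s" using ne by simp
    then have "\<forall>t'\<in>set s'. x \<le> t'" using lt by (metis mx Suc_leI x_def)
    moreover have "s \<in> separated_words x w"
      using su len by (auto simp: separated_words_def x_def less_Suc_eq_le)
    moreover have "s \<notin> separated_words (x - 1) w"
      using mx by (auto simp: separated_words_def x_def)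
    moreover have "x < a"
      using \<open>\<forall>t'\<in>set s'. x \<le> t'\<close> ne(2) su(2) by (metis last_in_set lessThan_iff order_le_less_trans subsetD)
    ultimately show "u \<in> (\<Union>x<a. (\<lambda>(s, s'). s @ s') ` (?F x \<times> ?L x))"
      using su(2) len(2) by (intro UN_I[of x] image_eqI[of _ _ "(s, s')"]) (auto simp: us)
  next
    fix u assume "u \<in> (\<Union>x<a. (\<lambda>(s, s'). s @ s') ` (?F x \<times> ?L x))"
    then obtain x s s' where x: "x < a" "s \<in> separated_words x w" "s' \<in> ?L x" "u = s @ s'" by auto
    then have "set s \<subseteq> {..<x}" "set s' \<subseteq> {x..<a}" and len: "length s = length w" "length s' = d"
      and "separated w s" by (auto simp: separated_words_def)
    moreover from this have "\<forall>t\<in>set s. \<forall>t'\<in>set s'. t < t'"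
      by (meson atLeastLessThan_iff lessThan_iff order_less_le_trans subsetD)
    ultimately show "u \<in> separated_words a (w @ replicate d b)"
      using sep[OF len] x(1) by (auto simp: separated_words_def x(4))
  qed
  have disj: "?F x \<inter> ?F y = {}" if "x < y" for x y
  proof -
    have "x \<le> y - 1" using that by simp
    from separated_words_mono[OF this, of w] show ?thesis by blast
  qed
  have pre: "\<exists>s s'. s \<in> A \<and> u = s @ s'" if "u \<in> (\<lambda>(s, s'). s @ s') ` (A \<times> B)"
    for u and A B :: "nat list set" using that by auto
  have len: "length s = length w" if "s \<in> ?F x" for s x using that by (auto simp: separated_words_def)
  have "card (separated_words a (w @ replicate d b)) =
      (\<Sum>x<a. card ((\<lambda>(s, s'). s @ s') ` (?F x \<times> ?L x)))"
    unfolding UN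
  proof (rule card_UN_disjoint)
    show "\<forall>x\<in>{..<a}. finite ((\<lambda>(s, s'). s @ s') ` (?F x \<times> ?L x))"
      by (auto simp: finite_separated_words finite_lists_length_eq)
    show "\<forall>x\<in>{..<a}. \<forall>y\<in>{..<a}. x \<noteq> y \<longrightarrow>
        (\<lambda>(s, s'). s @ s') ` (?F x \<times> ?L x) \<inter> (\<lambda>(s, s'). s @ s') ` (?F y \<times> ?L y) = {}"
    proof (intro ballI impI)
      fix x y :: nat assume "x \<noteq> y"
      then have empty: "?F x \<inter> ?F y = {}" using disj[of x y] disj[of y x] by (cases "x < y") auto
      show "(\<lambda>(s, s'). s @ s') ` (?F x \<times> ?L x) \<inter> (\<lambda>(s, s'). s @ s') ` (?F y \<times> ?L y) = {}"
      proof (rule equals0I)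
        fix u assume u: "u \<in> (\<lambda>(s, s'). s @ s') ` (?F x \<times> ?L x) \<inter> (\<lambda>(s, s'). s @ s') ` (?F y \<times> ?L y)"
        obtain s s' where "s \<in> ?F x" "u = s @ s'" using pre[OF IntD1[OF u]] by blast
        moreover obtain t t' where "t \<in> ?F y" "u = t @ t'" using pre[OF IntD2[OF u]] by blast
        ultimately have st: "s \<in> ?F x" "t \<in> ?F y" "u = s @ s'" "u = t @ t'" by simp_all
        then have "s = t" using len[of s x] len[of t y] by simp
        with st empty show False by blast
      qed
    qed
  qed simp
  also have "\<dots> = (\<Sum>x<a. card (?F x \<times> ?L x))"
    by (intro sum.cong refl card_image) (auto simp: inj_on_def separated_words_def)
  also have "\<dots> = (\<Sum>x<a. (card (separated_words x w) - card (separated_words (x - 1) w)) * (a - x) ^ d)"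
    by (simp add: card_cartesian_product card_lists_length_eq card_Diff_subset finite_separated_words
        separated_words_mono)
  finally show ?thesis .
qed

section \<open>The sum over chains\<close>

definition chain_sum :: "nat \<Rightarrow> nat \<Rightarrow> (nat \<Rightarrow> nat) \<Rightarrow> real" where
  "chain_sum a m D = (\<Sum>k\<in>index_chains m a.
         real_of_int (int a - k (m - 1)) ^ D m *
         (\<Prod>j=1..m-1. real_of_int (k j - k (j - 1)) ^ D j
                       - real_of_int (k j - k (j - 1) - 1) ^ D j))"

lemma index_chain_nonneg:
  assumes "k \<in> index_chains m a" "j \<le> m - 1"
  shows "0 \<le> k j"
  using assms(2)
proof (induction j)
  case (Suc j)
  have "k j < k (Suc j)"
    using assms(1) Suc.prems by (auto simp: index_chains_def Ball_def dest!: spec[of _ "Suc j"])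
  then show ?case using Suc by simp
qed (use assms(1) in \<open>simp add: index_chains_def\<close>)

text \<open>Every chain is obtained uniquely from a shorter one by appending its last entry \<open>x\<close>, which takes
  over the role of the upper bound for the shorter chain.\<close>
lemma index_chains_Suc:
  assumes "m \<ge> 1"
  shows "bij_betw (\<lambda>(x, k). k(m := int x)) (SIGMA x:{..<a}. index_chains m x) (index_chains (Suc m) a)"
proof (rule bij_betw_byWitness[where f' = "\<lambda>k. (nat (k m), restrict k {0..m-1})"])
  show "\<forall>xk\<in>SIGMA x:{..<a}. index_chains m x.
      (\<lambda>k. (nat (k m), restrict k {0..m-1})) ((\<lambda>(x, k). k(m := int x)) xk) = xk"
    using assms by (auto simp: index_chains_def extensional_def fun_eq_iff)
  have upper: "{0..Suc m - 1} = insert m {0..m-1}" using assms by auto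
  have nonneg: "0 \<le> k m" if "k \<in> index_chains (Suc m) a" for k
    using index_chain_nonneg[OF that, of m] by simp
  show "\<forall>k\<in>index_chains (Suc m) a.
      (\<lambda>(x, k). k(m := int x)) (nat (k m), restrict k {0..m-1}) = k"
    using nonneg assms by (auto simp: index_chains_def extensional_def fun_eq_iff)
  show "(\<lambda>(x, k). k(m := int x)) ` (SIGMA x:{..<a}. index_chains m x) \<subseteq> index_chains (Suc m) a"
  proof (rule image_subsetI, clarsimp)
    fix x k assume x: "x < a" and k: "k \<in> index_chains m x"
    have "(k(m := int x)) (j - 1) < (k(m := int x)) j" if "j \<in> {1..m}" for j
    proof (cases "j = m")
      case True
      then show ?thesis using k assms by (auto simp: index_chains_def)
    next
      case False
      then have "j \<in> {1..m-1}" using that by auto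
      then have "k (j - 1) < k j" using k unfolding index_chains_def by blast
      then show ?thesis using False that by auto
    qed
    then show "k(m := int x) \<in> index_chains (Suc m) a"
      using x k assms unfolding index_chains_def upper by (auto simp: extensional_def)
  qed
  show "(\<lambda>k. (nat (k m), restrict k {0..m-1})) ` index_chains (Suc m) a \<subseteq> (SIGMA x:{..<a}. index_chains m x)"
  proof (rule image_subsetI)
    fix k assume k: "k \<in> index_chains (Suc m) a"
    have "k (m - 1) < k m" using k assms by (auto simp: index_chains_def)
    then show "(nat (k m), restrict k {0..m-1}) \<in> (SIGMA x:{..<a}. index_chains m x)"
      using k nonneg[OF k] assms by (auto simp: index_chains_def)
  qed
qed

text \<open>The sum for the bound \<open>x - 1\<close> may be taken over the chains for the bound \<open>x\<close>: the additional
  chains end in \<open>x - 1\<close>, and their term contains the factor \<open>0 ^ D m\<close>. This lets the difference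
  in \<open>chain_sum_Suc\<close> be formed termwise.\<close>
lemma chain_sum_pred:
  assumes "m \<ge> 1" "D m \<ge> 1" "x \<ge> 1"
  shows "chain_sum (x - 1) m D = (\<Sum>k\<in>index_chains m x.
         real_of_int (int x - k (m - 1) - 1) ^ D m *
         (\<Prod>j=1..m-1. real_of_int (k j - k (j - 1)) ^ D j
                       - real_of_int (k j - k (j - 1) - 1) ^ D j))"
  unfolding chain_sum_def
proof (rule sum.mono_neutral_cong_left)
  show "finite (index_chains m x)" by (rule finite_index_chains)
  show "index_chains m (x - 1) \<subseteq> index_chains m x" by (auto simp: index_chains_def)
  show "\<forall>k\<in>index_chains m x - index_chains m (x - 1).
         real_of_int (int x - k (m - 1) - 1) ^ D m *
         (\<Prod>j=1..m-1. real_of_int (k j - k (j - 1)) ^ D j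
                       - real_of_int (k j - k (j - 1) - 1) ^ D j) = 0"
  proof
    fix k assume "k \<in> index_chains m x - index_chains m (x - 1)"
    then have "k (m - 1) = int x - 1" using assms by (auto simp: index_chains_def)
    then show "real_of_int (int x - k (m - 1) - 1) ^ D m *
         (\<Prod>j=1..m-1. real_of_int (k j - k (j - 1)) ^ D j
                       - real_of_int (k j - k (j - 1) - 1) ^ D j) = 0"
      using assms by simp
  qed
qed (use assms in \<open>auto simp: of_nat_diff algebra_simps\<close>)

lemma index_chains_0: "m \<ge> 1 \<Longrightarrow> index_chains m 0 = {}"
  using index_chain_nonneg[of _ m 0 "m - 1"] by (force simp: index_chains_def)

text \<open>For \<open>x = k m\<close>, the factor of label \<open>m\<close> in the product is the difference between the leading
  factors of the sums for \<open>m\<close> labels with bounds \<open>x\<close> and \<open>x - 1\<close>.\<close>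
lemma chain_sum_Suc:
  assumes "m \<ge> 1" "D m \<ge> 1"
  shows "chain_sum a (Suc m) D =
    (\<Sum>x<a. (chain_sum x m D - chain_sum (x - 1) m D) * real (a - x) ^ D (Suc m))"
proof -
  let ?P = "\<lambda>m k. \<Prod>j=1..m-1. real_of_int (k j - k (j - 1)) ^ D j
                       - real_of_int (k j - k (j - 1) - 1) ^ D j"
  have P: "?P (Suc m) (k(m := int x)) = ?P m k *
      (real_of_int (int x - k (m - 1)) ^ D m - real_of_int (int x - k (m - 1) - 1) ^ D m)" for k :: "nat \<Rightarrow> int" and x
  proof -
    let ?k = "k(m := int x)"
    let ?g = "\<lambda>k j. real_of_int (k j - k (j - 1)) ^ D j - real_of_int (k j - k (j - 1) - 1) ^ D j"
    have "{1..Suc m - 1} = insert m {1..m-1}" using assms(1) by auto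
    then have "prod (?g ?k) {1..Suc m - 1} = prod (?g ?k) (insert m {1..m-1})"
      by (rule arg_cong)
    also have "\<dots> = ?g ?k m * prod (?g ?k) {1..m-1}"
      by (rule prod.insert) (use assms(1) in auto)
    also have "prod (?g ?k) {1..m-1} = prod (?g k) {1..m-1}"
      by (rule prod.cong) auto
    also have "?g ?k m = real_of_int (int x - k (m - 1)) ^ D m - real_of_int (int x - k (m - 1) - 1) ^ D m"
    proof -
      have ne: "m - 1 \<noteq> m" using assms(1) by simp
      show ?thesis unfolding fun_upd_other[OF ne] fun_upd_same ..
    qed
    finally show ?thesis by (simp only: mult.commute)
  qed
  have "chain_sum a (Suc m) D = (\<Sum>(x, k)\<in>(SIGMA x:{..<a}. index_chains m x).
      real_of_int (int a - int x) ^ D (Suc m) * ?P (Suc m) (k(m := int x)))"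
    unfolding chain_sum_def
    by (subst sum.reindex_bij_betw[OF index_chains_Suc[OF assms(1)], symmetric])
       (auto intro!: sum.cong)
  also have "\<dots> = (\<Sum>x<a. \<Sum>k\<in>index_chains m x.
      real_of_int (int a - int x) ^ D (Suc m) * ?P (Suc m) (k(m := int x)))"
    by (subst sum.Sigma) (auto simp: finite_index_chains)
  also have "\<dots> = (\<Sum>x<a. (chain_sum x m D - chain_sum (x - 1) m D) * real (a - x) ^ D (Suc m))"
  proof (rule sum.cong[OF refl])
    fix x assume "x \<in> {..<a}"
    then have ax: "real_of_int (int a - int x) = real (a - x)" by simp
    show "(\<Sum>k\<in>index_chains m x. real_of_int (int a - int x) ^ D (Suc m) * ?P (Suc m) (k(m := int x))) =
        (chain_sum x m D - chain_sum (x - 1) m D) * real (a - x) ^ D (Suc m)"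
    proof (cases "x = 0")
      case True
      then show ?thesis by (simp add: index_chains_0[OF assms(1)])
    next
      case False
      then have "x \<ge> 1" by simp
      show ?thesis
        unfolding P ax chain_sum_pred[of m D x, OF assms \<open>x \<ge> 1\<close>] unfolding chain_sum_def sum_subtractf[symmetric] sum_distrib_right
        by (rule sum.cong) (simp_all add: algebra_simps)
    qed
  qed
  finally show ?thesis .
qed

lemma chain_sum_1:
  assumes "D 1 \<ge> 1"
  shows "chain_sum a 1 D = real a ^ D 1"
proof (cases "a = 0")
  case True
  then show ?thesis using assms by (simp add: chain_sum_def index_chains_0)
next
  case False
  then have "index_chains 1 a = {\<lambda>i. if i = 0 then 0 else undefined}"
    by (auto simp: index_chains_def extensional_def fun_eq_iff)
  then show ?thesis by (simp add: chain_sum_def)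
qed

lemma card_separated_words_sorted_deck:
  assumes "m \<ge> 1" "\<And>i. i \<in> {1..m} \<Longrightarrow> D i \<ge> 1"
  shows "real (card (separated_words a (sorted_deck m D))) = chain_sum a m D"
  using assms
proof (induction m arbitrary: a rule: dec_induct)
  case base
  have "separated_words a (sorted_deck 1 D) = {s. set s \<subseteq> {..<a} \<and> length s = D 1}"
    by (auto simp: separated_words_def sorted_deck_def separated_replicate)
  then show ?case using base chain_sum_1[of D a] by (simp add: card_lists_length_eq)
next
  case (step m)
  have IH: "real (card (separated_words x (sorted_deck m D))) = chain_sum x m D" for x
    using step by simp
  have "1 \<in> {1..m}" using step.hyps by simp
  then have "sorted_deck m D \<noteq> []"
    using count_sorted_deck[of m D 1] step.prems[of 1] by auto
  then have "card (separated_words a (sorted_deck (Suc m) D)) = (\<Sum>x<a.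
      (card (separated_words x (sorted_deck m D)) - card (separated_words (x - 1) (sorted_deck m D)))
      * (a - x) ^ D (Suc m))"
    unfolding sorted_deck_Suc
    using set_sorted_deck[of m D] step.prems[of "Suc m"]
    by (intro card_separated_words_append_replicate) fastforce+
  then have "real (card (separated_words a (sorted_deck (Suc m) D))) = (\<Sum>x<a.
      (chain_sum x m D - chain_sum (x - 1) m D) * real (a - x) ^ D (Suc m))"
    by (simp add: of_nat_diff card_mono finite_separated_words separated_words_mono IH)
  then show ?case
    using step by (simp add: chain_sum_Suc)
qed

section \<open>The separation distance\<close>

lemma sorted_sorted_deck: "sorted (sorted_deck m D)"
proof (induction m)
  case (Suc m)
  then show ?case
    using set_sorted_deck[of m D] by (fastforce simp: sorted_deck_Suc sorted_append)
qed (simp add: sorted_deck_def)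

theorem theorem4p2:
  fixes m a n :: nat and D :: "nat \<Rightarrow> nat"
  assumes "m \<ge> 1" and "a \<ge> 1"
    and "\<And>i. i \<in> {1..m} \<Longrightarrow> D i \<ge> 1"
    and "n = (\<Sum>i=1..m. D i)"
  shows "separation_distance a m D =
    1 - 1 / real a ^ n * real (multinomial (map D [1..<Suc m])) *
      (\<Sum>k\<in>index_chains m a.
         real_of_int (int a - k (m - 1)) ^ D m *
         (\<Prod>j=1..m-1. real_of_int (k j - k (j - 1)) ^ D j
                       - real_of_int (k j - k (j - 1) - 1) ^ D j))"
proof -
  let ?d = "sorted_deck m D"
  let ?M = "real (multinomial (map D [1..<Suc m]))"
  let ?f = "\<lambda>w. 1 - pmf (a_shuffle a ?d) w / (1 / ?M)"
  have f: "?f w = 1 - 1 / real a ^ n * ?M * real (card (inverse_words a ?d w))" for w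
    by (simp add: pmf_a_shuffle[OF assms(2)] length_sorted_deck assms(4) del: upt_Suc)
  have rev_count: "real (card (inverse_words a ?d (rev ?d))) = chain_sum a m D"
  proof -
    have "sorted_wrt (\<ge>) (rev ?d)" using sorted_sorted_deck[of m D] by (simp add: sorted_wrt_rev)
    then have "inverse_words a ?d (rev ?d) = separated_words a (rev ?d)"
      using separated_words_subset_inverse_words[of "rev ?d" ?d a]
        inverse_words_descending[of ?d "rev ?d" a] sorted_sorted_deck by auto
    then show ?thesis
      using card_separated_words_mset[of "rev ?d" ?d a]
        card_separated_words_sorted_deck[of m D a, OF assms(1,3)] by simp
  qed
  have min: "chain_sum a m D \<le> real (card (inverse_words a ?d w))" if "w \<in> configurations m D" for w
  proof -
    have w: "mset w = mset ?d"
      using that by (simp add: configurations_eq permutations_of_multiset_def)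
    have "card (separated_words a ?d) \<le> card (inverse_words a ?d w)"
      using card_separated_words_mset[OF w, of a]
        separated_words_subset_inverse_words[OF w sorted_sorted_deck, of a]
      by (metis card_mono finite_inverse_words)
    then have "real (card (separated_words a ?d)) \<le> real (card (inverse_words a ?d w))"
      by (rule of_nat_mono)
    then show ?thesis using card_separated_words_sorted_deck[of m D a, OF assms(1,3)] by simp
  qed
  have "separation_distance a m D = Max (?f ` configurations m D)"
    by (simp add: separation_distance_def Let_def)
  also have "\<dots> = ?f (rev ?d)"
  proof (rule Max_eqI)
    show "finite (?f ` configurations m D)" by (simp add: finite_configurations)
    show "?f (rev ?d) \<in> ?f ` configurations m D"
      by (rule imageI) (simp add: configurations_eq permutations_of_multiset_def)
    fix y assume "y \<in> ?f ` configurations m D"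
    then obtain w where w: "w \<in> configurations m D" "y = ?f w" by blast
    show "y \<le> ?f (rev ?d)"
      unfolding w(2) f rev_count
      by (intro diff_left_mono mult_left_mono min w) simp
  qed
  also have "\<dots> = 1 - 1 / real a ^ n * ?M * chain_sum a m D"
    unfolding f rev_count ..
  finally show ?thesis unfolding chain_sum_def .
qed

end
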